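(* Let $(X,T)$ be an M-system. Then the following properties of $(X,T)$ are equivalent: (a) $(X,T)$ is thickly syndetically sensitive; (b) $(X,T)$ is multi-sensitive; (c) $(X,T)$ is thickly sensitive.
   Context: A dynamical system $(X,T)$ consists of a nonempty compact metric space $X$ (metric $d$) and a continuous surjective map $T:X\to X$; by standing assumption $X$ has no isolated points and is not a singleton. $\mathbb{Z}_+$ is the set of nonnegative integers. "Opene" means open and nonempty. The system is transitive if for all opene $U,V\subset X$ there is $n\in\mathbb{Z}_+$ with $U\cap T^{-n}V\neq\varnothing$. A point is minimal if it lies in a minimal subset, i.e. a nonempty closed set $A$ with $TA=A$ such that every orbit $\{T^na:n\ge 0\}$, $a\in A$, is dense in $A$. An M-system is a transitive system with a dense set of minimal points. A subset $F\subset\mathbb{Z}_+$ is thick if it contains arbitrarily long runs of consecutive positive integers; syndetic if there is $N\in\mathbb{N}$ with $\{i,i+1,\dots,i+N\}\cap F\neq\varnothing$ for every $i\in\mathbb{Z}_+$; thickly syndetic if for every $N\in\mathbb{N}$ the positions where length-$N$ runs of $F$ begin form a syndetic set. For $\delta>0$ and opene $U\subset X$, $S_T(U,\delta)=\{n\in\mathbb{Z}_+:\text{there are }x_1,x_2\in U\text{ with }d(T^nx_1,T^nx_2)>\delta\}$. The system is thickly sensitive (respectively thickly syndetically sensitive) if there is $\delta>0$ such that $S_T(U,\delta)$ is thick (respectively thickly syndetic) for every opene $U\subset X$; it is multi-sensitive if there is $\delta>0$ such that $\bigcap_{i=1}^kS_T(U_i,\delta)\neq\varnothing$ for every finite collection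 of opene $U_1,\dots,U_k\subset X$. *)

theory Defs
  imports "HOL-Analysis.Analysis"
begin

text \<open>
  A system is given by a carrier set \<open>X\<close> in an ambient metric space together with a map \<open>T\<close> on the
  ambient type, of which only the restriction to \<open>X\<close> is relevant. All topological notions
  are relative to \<open>X\<close>. Time \<open>n\<close> ranges over \<open>nat\<close>, including 0.
\<close>

text \<open>
  The standing assumptions that \<open>X\<close> has no isolated points and is not a singleton are included.
\<close>

definition dynamical_system :: "'a::metric_space set \<Rightarrow> ('a \<Rightarrow> 'a) \<Rightarrow> bool" where
  "dynamical_system X T \<longleftrightarrow>
     X \<noteq> {} \<and> compact X \<and> continuous_on X T \<and> T ` X = X \<and>
     (\<forall>x\<in>X. x islimpt X) \<and> (\<nexists>x. X = {x})"

definition opene :: "'a::metric_space set \<Rightarrow> 'a set \<Rightarrow> bool" where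
  "opene X U \<longleftrightarrow> openin (top_of_set X) U \<and> U \<noteq> {}"

definition transitive_system :: "'a::metric_space set \<Rightarrow> ('a \<Rightarrow> 'a) \<Rightarrow> bool" where
  "transitive_system X T \<longleftrightarrow> dynamical_system X T \<and>
     (\<forall>U V. opene X U \<and> opene X V \<longrightarrow> (\<exists>n. U \<inter> (T ^^ n) -` V \<noteq> {}))"

text \<open>
  Density of an orbit in \<open>A\<close> is expressed by \<open>A \<subseteq> closure\<close>; the orbit lies in \<open>A\<close> because
  \<open>T ` A = A\<close>.
\<close>

definition minimal_set :: "'a::metric_space set \<Rightarrow> ('a \<Rightarrow> 'a) \<Rightarrow> 'a set \<Rightarrow> bool" where
  "minimal_set X T A \<longleftrightarrow>
     A \<noteq> {} \<and> closedin (top_of_set X) A \<and> T ` A = A \<and>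
     (\<forall>a\<in>A. A \<subseteq> closure {(T ^^ n) a |n. True})"

definition minimal_point :: "'a::metric_space set \<Rightarrow> ('a \<Rightarrow> 'a) \<Rightarrow> 'a \<Rightarrow> bool" where
  "minimal_point X T x \<longleftrightarrow> (\<exists>A. minimal_set X T A \<and> x \<in> A)"

definition M_system :: "'a::metric_space set \<Rightarrow> ('a \<Rightarrow> 'a) \<Rightarrow> bool" where
  "M_system X T \<longleftrightarrow> transitive_system X T \<and> X \<subseteq> closure {x. minimal_point X T x}"

definition thick :: "nat set \<Rightarrow> bool" where
  "thick F \<longleftrightarrow> (\<forall>N\<ge>1. \<exists>m\<ge>1. {m..<m+N} \<subseteq> F)"

definition syndetic :: "nat set \<Rightarrow> bool" where
  "syndetic F \<longleftrightarrow> (\<exists>N. \<forall>i. {i..i+N} \<inter> F \<noteq> {})"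

definition thickly_syndetic :: "nat set \<Rightarrow> bool" where
  "thickly_syndetic F \<longleftrightarrow> (\<forall>N\<ge>1. syndetic {i. {i..<i+N} \<subseteq> F})"

definition sens_times :: "('a::metric_space \<Rightarrow> 'a) \<Rightarrow> 'a set \<Rightarrow> real \<Rightarrow> nat set" where
  "sens_times T U \<delta> = {n. \<exists>x1\<in>U. \<exists>x2\<in>U. dist ((T ^^ n) x1) ((T ^^ n) x2) > \<delta>}"

definition thickly_sensitive :: "'a::metric_space set \<Rightarrow> ('a \<Rightarrow> 'a) \<Rightarrow> bool" where
  "thickly_sensitive X T \<longleftrightarrow> (\<exists>\<delta>>0. \<forall>U. opene X U \<longrightarrow> thick (sens_times T U \<delta>))"

definition thickly_syndetically_sensitive :: "'a::metric_space set \<Rightarrow> ('a \<Rightarrow> 'a) \<Rightarrow> bool" where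
  "thickly_syndetically_sensitive X T \<longleftrightarrow>
     (\<exists>\<delta>>0. \<forall>U. opene X U \<longrightarrow> thickly_syndetic (sens_times T U \<delta>))"

definition multi_sensitive :: "'a::metric_space set \<Rightarrow> ('a \<Rightarrow> 'a) \<Rightarrow> bool" where
  "multi_sensitive X T \<longleftrightarrow>
     (\<exists>\<delta>>0. \<forall>\<U>. finite \<U> \<and> \<U> \<noteq> {} \<and> (\<forall>U\<in>\<U>. opene X U) \<longrightarrow>
        (\<Inter>U\<in>\<U>. sens_times T U \<delta>) \<noteq> {})"

end

theory Submission
  imports Defs
begin

text \<open>
  The heart of the matter is that, when minimal points are dense, thickness of
  \<open>sens_times T U \<delta>\<close> for a single opene \<open>U\<close> and a single \<open>\<delta>\<close> already forces that set to be
  thickly syndetic. If \<open>{m..<m+N}\<close> consists of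
  sensitivity times, each of these \<open>N\<close> times is witnessed by a pair of points of \<open>U\<close>, and by
  continuity by a pair of opene subsets of \<open>U\<close> whose images stay more than \<open>\<delta>\<close> apart. At any
  time \<open>n\<close> at which all \<open>2N\<close> subsets simultaneously return to themselves, the whole block shifted
  by \<open>n\<close> consists of sensitivity times again. So everything reduces to showing that finitely many
  opene sets have a syndetic set of common return times (\<open>syndetic_common_returns\<close>).

  Each of the opene sets contains a minimal point, whose visiting times to the set are syndetic, and
  differences of visiting times are return times of the set. The visiting times of different
  minimal points need not be synchronized, but their differences are: colour a time \<open>t\<close> by the
  waiting times until the next visits. There are finitely many colours, two times of the same
  colour differ by a common difference, and comparing \<open>t\<close> with a fixed finite set of
  representatives of the colours places such a difference within bounded distance of \<open>t\<close>
  (\<open>syndetic_common_differences\<close>).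

  The other implications are soft. Thickly syndetic sets form a filter, which yields
  multi-sensitivity. Conversely, applying multi-sensitivity to the preimages
  \<open>U, T\<^sup>-\<^sup>1 U, \<dots>, T\<^sup>-\<^sup>N U\<close> gives \<open>N\<close> consecutive sensitivity times of \<open>U\<close>.
\<close>

section \<open>Large sets of natural numbers\<close>

lemma thickly_syndetic_imp_thick:
  assumes "thickly_syndetic F"
  shows "thick F"
  unfolding thick_def
proof (intro allI impI)
  fix N :: nat assume "N \<ge> 1"
  then obtain g where g: "\<And>i. {i..i+g} \<inter> {i. {i..<i+N} \<subseteq> F} \<noteq> {}"
    using assms unfolding thickly_syndetic_def syndetic_def by blast
  then obtain m where "m \<in> {1..1+g}" "{m..<m+N} \<subseteq> F"
    using g[of 1] by blast
  then show "\<exists>m\<ge>1. {m..<m+N} \<subseteq> F" by auto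
qed

lemma thick_nonempty: "thick F \<Longrightarrow> F \<noteq> {}"
  unfolding thick_def by fastforce

text \<open>
  A run of length \<open>N\<close> in \<open>F\<close> starts within every window of some length \<open>f\<close>, in particular
  inside any run of length \<open>N + f\<close> in \<open>G\<close>; the latter runs start syndetically often.
\<close>

lemma thickly_syndetic_Int:
  assumes F: "thickly_syndetic F" and G: "thickly_syndetic G"
  shows "thickly_syndetic (F \<inter> G)"
  unfolding thickly_syndetic_def
proof (intro allI impI)
  fix N :: nat assume N: "N \<ge> 1"
  obtain f where f: "\<And>i. {i..i+f} \<inter> {i. {i..<i+N} \<subseteq> F} \<noteq> {}"
    using F N unfolding thickly_syndetic_def syndetic_def by blast
  have "N + f \<ge> 1" using N by simp
  then obtain g where g: "\<And>i. {i..i+g} \<inter> {i. {i..<i+(N+f)} \<subseteq> G} \<noteq> {}"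
    using G unfolding thickly_syndetic_def syndetic_def by blast
  have "{i..i+(g+f)} \<inter> {i. {i..<i+N} \<subseteq> F \<inter> G} \<noteq> {}" for i
  proof -
    obtain j where j: "j \<in> {i..i+g}" "{j..<j+(N+f)} \<subseteq> G" using g[of i] by blast
    obtain k where k: "k \<in> {j..j+f}" "{k..<k+N} \<subseteq> F" using f[of j] by blast
    have "{k..<k+N} \<subseteq> {j..<j+(N+f)}" using k(1) by auto
    moreover have "k \<in> {i..i+(g+f)}" using j(1) k(1) by auto
    ultimately show ?thesis using j(2) k(2) by blast
  qed
  then show "syndetic {i. {i..<i+N} \<subseteq> F \<inter> G}"
    unfolding syndetic_def by blast
qed

lemma thickly_syndetic_INT:
  assumes "finite \<A>" "\<A> \<noteq> {}" "\<And>A. A \<in> \<A> \<Longrightarrow> thickly_syndetic (F A)"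
  shows "thickly_syndetic (\<Inter>A\<in>\<A>. F A)"
  using assms by (induction rule: finite_ne_induct) (auto intro: thickly_syndetic_Int)

lemma syndetic_shift_superset:
  assumes "syndetic F" and "\<And>n. n \<in> F \<Longrightarrow> m + n \<in> G"
  shows "syndetic G"
proof -
  obtain g where g: "\<And>i. {i..i+g} \<inter> F \<noteq> {}"
    using assms(1) unfolding syndetic_def by blast
  have "{i..i+(m+g)} \<inter> G \<noteq> {}" for i
  proof -
    obtain n where "n \<in> {i..i+g}" "n \<in> F" using g[of i] by blast
    then have "m + n \<in> {i..i+(m+g)}" "m + n \<in> G" using assms(2) by auto
    then show ?thesis by blast
  qed
  then show ?thesis unfolding syndetic_def by blast
qed

text \<open>
  The intersection of two syndetic sets may be empty, as for the even and the odd numbers. The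
  difference sets do not suffer from this: the pigeonhole principle treats all of them at once.
\<close>

lemma syndetic_common_differences:
  assumes "finite I" and R: "\<And>k. k \<in> I \<Longrightarrow> syndetic (R k)"
  shows "syndetic {n. \<forall>k\<in>I. \<exists>r\<in>R k. r + n \<in> R k}" (is "syndetic ?Q")
proof -
  have "\<forall>k\<in>I. \<exists>g. \<forall>t. \<exists>w\<le>g. t + w \<in> R k"
  proof
    fix k assume "k \<in> I"
    then obtain g where g: "\<And>i. {i..i+g} \<inter> R k \<noteq> {}"
      using R unfolding syndetic_def by blast
    have "\<exists>w\<le>g. t + w \<in> R k" for t
    proof -
      obtain r where "r \<in> {t..t+g}" "r \<in> R k" using g[of t] by blast
      then show ?thesis by (intro exI[of _ "r - t"]) auto
    qed
    then show "\<exists>g. \<forall>t. \<exists>w\<le>g. t + w \<in> R k" by blast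
  qed
  then obtain g where "\<forall>k\<in>I. \<forall>t. \<exists>w\<le>g k. t + w \<in> R k" by metis
  then obtain w where w: "\<And>k t. k \<in> I \<Longrightarrow> w k t \<le> g k \<and> t + w k t \<in> R k" by metis
  define colour where "colour t = restrict (\<lambda>k. w k t) I" for t
  have "range colour \<subseteq> (\<Pi>\<^sub>E k\<in>I. {..g k})"
    using w by (auto simp: colour_def)
  then have "finite (range colour)"
    by (rule finite_subset) (simp add: finite_PiE \<open>finite I\<close>)
  then obtain S where S: "finite S" "range colour = colour ` S"
    using finite_subset_image[of "range colour" colour UNIV] by blast
  \<comment> \<open>Evaluated at a common colour, equal waiting times cancel in the difference.\<close>
  have diff: "t - s \<in> ?Q" if "colour s = colour t" "s \<le> t" for s t
  proof -
    have "\<exists>r\<in>R k. r + (t - s) \<in> R k" if "k \<in> I" for k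
    proof -
      have "w k s = w k t"
        using \<open>colour s = colour t\<close> that unfolding colour_def by (metis restrict_apply')
      then have "(s + w k s) + (t - s) = t + w k t" using \<open>s \<le> t\<close> by simp
      then show ?thesis using w[OF that] by metis
    qed
    then show ?thesis by blast
  qed
  have "{i..i + Max S} \<inter> ?Q \<noteq> {}" for i
  proof -
    have "colour (i + Max S) \<in> colour ` S" using S(2) by blast
    then obtain s where s: "s \<in> S" "colour s = colour (i + Max S)" by auto
    have "s \<le> Max S" using s(1) S(1) by simp
    then have "i + Max S - s \<in> {i..i + Max S}" "i + Max S - s \<in> ?Q"
      using diff[OF s(2)] by auto
    then show ?thesis by blast
  qed
  then show ?thesis unfolding syndetic_def by blast
qed

section \<open>Iterates and open sets\<close>

lemma dynamical_systemD:
  assumes "dynamical_system X T"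
  shows "X \<noteq> {}" "compact X" "continuous_on X T" "T ` X = X"
  using assms unfolding dynamical_system_def by auto

lemma funpow_image:
  assumes "T ` X = X"
  shows "(T ^^ n) ` X = X"
proof (induction n)
  case (Suc n)
  have "(T ^^ Suc n) ` X = T ` (T ^^ n) ` X" by (simp add: image_image)
  then show ?case using Suc assms by (simp only:)
qed simp

lemma continuous_on_funpow:
  fixes T :: "'a::metric_space \<Rightarrow> 'a"
  assumes "continuous_on X T" "T ` X = X"
  shows "continuous_on X (T ^^ n)"
proof (induction n)
  case (Suc n)
  then show ?case
    using continuous_on_compose[of X "T ^^ n" T] assms funpow_image[OF assms(2), of n] by simp
qed (simp add: continuous_on_id')

lemma funpow_add_apply: "(T ^^ (m + n)) x = (T ^^ m) ((T ^^ n) x)"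
  by (simp add: funpow_add)

lemma opene_funpow_vimage:
  assumes "dynamical_system X T" "opene X U"
  shows "opene X (X \<inter> (T ^^ n) -` U)"
proof -
  note X = dynamical_systemD[OF assms(1)]
  have "U \<subseteq> X" "U \<noteq> {}" "openin (top_of_set X) U"
    using assms(2) openin_imp_subset unfolding opene_def by auto
  moreover have onto: "(T ^^ n) ` X = X" by (rule funpow_image[OF X(4)])
  ultimately obtain u where "u \<in> U" "u \<in> (T ^^ n) ` X" by auto
  then have "X \<inter> (T ^^ n) -` U \<noteq> {}" by auto
  moreover have "openin (top_of_set X) (X \<inter> (T ^^ n) -` U)"
    using continuous_openin_preimage[OF continuous_on_funpow[OF X(3,4)], of n X U]
      onto \<open>openin (top_of_set X) U\<close> by auto
  ultimately show ?thesis unfolding opene_def by blast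
qed

lemma openin_funpow_close:
  assumes "dynamical_system X T" "openin (top_of_set X) U"
  shows "openin (top_of_set X) {a\<in>U. dist ((T ^^ n) a) ((T ^^ n) x) < e}"
proof -
  note X = dynamical_systemD[OF assms(1)]
  have "openin (top_of_set X) (X \<inter> (T ^^ n) -` ball ((T ^^ n) x) e)"
    by (rule continuous_openin_preimage_gen[OF continuous_on_funpow[OF X(3,4)] open_ball])
  then have "openin (top_of_set X) (U \<inter> (X \<inter> (T ^^ n) -` ball ((T ^^ n) x) e))"
    using assms(2) by blast
  moreover have "U \<inter> (X \<inter> (T ^^ n) -` ball ((T ^^ n) x) e)
      = {a\<in>U. dist ((T ^^ n) a) ((T ^^ n) x) < e}"
    using openin_imp_subset[OF assms(2)] by (auto simp: dist_commute)
  ultimately show ?thesis by simp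
qed

lemma sens_times_open_witnesses:
  assumes ds: "dynamical_system X T" and U: "opene X U" and n: "n \<in> sens_times T U \<delta>"
  obtains V W where "opene X V" "opene X W" "V \<subseteq> U" "W \<subseteq> U"
    "\<And>a b. a \<in> V \<Longrightarrow> b \<in> W \<Longrightarrow> dist ((T ^^ n) a) ((T ^^ n) b) > \<delta>"
proof -
  obtain x y where xy: "x \<in> U" "y \<in> U" "dist ((T ^^ n) x) ((T ^^ n) y) > \<delta>"
    using n unfolding sens_times_def by blast
  define e where "e = (dist ((T ^^ n) x) ((T ^^ n) y) - \<delta>) / 2"
  define N where "N z = {a\<in>U. dist ((T ^^ n) a) ((T ^^ n) z) < e}" for z
  have "e > 0" using xy(3) by (simp add: e_def)
  then have "opene X (N z)" if "z \<in> U" for z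
    using that openin_funpow_close[OF ds] U unfolding opene_def N_def by fastforce
  moreover have "dist ((T ^^ n) a) ((T ^^ n) b) > \<delta>" if "a \<in> N x" "b \<in> N y" for a b
  proof -
    have "dist ((T ^^ n) a) ((T ^^ n) x) < e" "dist ((T ^^ n) b) ((T ^^ n) y) < e"
      using that unfolding N_def by auto
    moreover have "dist ((T ^^ n) x) ((T ^^ n) y) \<le> dist ((T ^^ n) a) ((T ^^ n) x)
        + dist ((T ^^ n) a) ((T ^^ n) b) + dist ((T ^^ n) b) ((T ^^ n) y)"
      using dist_triangle[of "(T ^^ n) x" "(T ^^ n) y" "(T ^^ n) a"]
        dist_triangle[of "(T ^^ n) a" "(T ^^ n) y" "(T ^^ n) b"]
      by (simp add: dist_commute)
    moreover have "dist ((T ^^ n) x) ((T ^^ n) y) = \<delta> + 2 * e" by (simp add: e_def field_simps)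
    ultimately show ?thesis by linarith
  qed
  moreover have "N z \<subseteq> U" for z unfolding N_def by blast
  ultimately show thesis using that[of "N x" "N y"] xy(1,2) by presburger
qed

text \<open>
  A small enough open set avoids sensitivity for as long as desired. Adding it to a family forces
  the common sensitivity times provided by multi-sensitivity to be late.
\<close>

lemma ex_opene_late_sens_times:
  assumes ds: "dynamical_system X T" and "\<delta> > 0"
  obtains V where "opene X V" "\<And>n. n \<in> sens_times T V \<delta> \<Longrightarrow> n > K"
proof -
  note X = dynamical_systemD[OF ds]
  obtain x where x: "x \<in> X" using X(1) by blast
  define B where "B k = {a\<in>X. dist ((T ^^ k) a) ((T ^^ k) x) < \<delta>/2}" for k
  define V where "V = (\<Inter>k\<in>{..K}. B k)"
  have "openin (top_of_set X) V"
    unfolding V_def B_def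
    by (intro openin_Inter) (auto intro!: openin_funpow_close[OF ds] simp del: less_divide_eq_numeral1)
  moreover have "x \<in> V" using x \<open>\<delta> > 0\<close> by (auto simp: V_def B_def)
  ultimately have "opene X V" unfolding opene_def by blast
  moreover have "n > K" if n: "n \<in> sens_times T V \<delta>" for n
  proof (rule ccontr)
    assume "\<not> n > K"
    then have close: "dist ((T ^^ n) a) ((T ^^ n) x) < \<delta>/2" if "a \<in> V" for a
      using that unfolding V_def B_def by auto
    obtain a b where "a \<in> V" "b \<in> V" "dist ((T ^^ n) a) ((T ^^ n) b) > \<delta>"
      using n unfolding sens_times_def by blast
    then show False
      using dist_triangle_half_l[of "(T ^^ n) a" "(T ^^ n) x" \<delta> "(T ^^ n) b"] close
      by fastforce
  qed
  ultimately show thesis using that by blast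
qed

section \<open>Return times\<close>

text \<open>
  Compactness makes the recurrence of minimal points uniform: every orbit in the minimal set enters
  \<open>U\<close>, so finitely many preimages of \<open>U\<close> cover the minimal set, and the entrance time is bounded
  along the whole orbit.
\<close>

lemma syndetic_visits_minimal_point:
  assumes ds: "dynamical_system X T" and U: "openin (top_of_set X) U"
    and z: "minimal_point X T z" "z \<in> U"
  shows "syndetic {n. (T ^^ n) z \<in> U}"
proof -
  note X = dynamical_systemD[OF ds]
  obtain A where A: "closedin (top_of_set X) A" "T ` A = A"
      "\<And>a. a \<in> A \<Longrightarrow> A \<subseteq> closure {(T ^^ n) a |n. True}" and "z \<in> A"
    using z(1) unfolding minimal_point_def minimal_set_def by blast
  have "A \<subseteq> X" using A(1) by (rule closedin_imp_subset)
  have "compact A" using closedin_compact[OF X(2) A(1)] .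
  have cont: "continuous_on A (T ^^ j)" for j
    by (rule continuous_on_funpow[OF continuous_on_subset[OF X(3) \<open>A \<subseteq> X\<close>] A(2)])
  have orbit: "(T ^^ j) a \<in> A" if "a \<in> A" for j a
    using funpow_image[OF A(2), of j] that by blast
  obtain O' where O': "open O'" "U = X \<inter> O'" using U unfolding openin_open by blast
  have "\<exists>C. open C \<and> A \<inter> (T ^^ j) -` O' = A \<inter> C" for j
    using continuous_openin_preimage_gen[OF cont O'(1), of j] unfolding openin_open by blast
  then obtain C where C: "\<And>j. open (C j)" "\<And>j. A \<inter> (T ^^ j) -` O' = A \<inter> C j"
    by metis
  have "A \<subseteq> (\<Union>j\<in>UNIV. C j)"
  proof
    fix a assume "a \<in> A"
    then have "z \<in> closure {(T ^^ n) a |n. True}" using A(3) \<open>z \<in> A\<close> by blast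
    moreover have "z \<in> O'" using z(2) O'(2) by blast
    ultimately have "O' \<inter> {(T ^^ n) a |n. True} \<noteq> {}"
      using O'(1) open_Int_closure_eq_empty by blast
    then obtain n where "(T ^^ n) a \<in> O'" by blast
    then show "a \<in> (\<Union>j\<in>UNIV. C j)" using C(2) \<open>a \<in> A\<close> by blast
  qed
  then obtain J where J: "finite J" "A \<subseteq> (\<Union>j\<in>J. C j)"
    using compactE_image[OF \<open>compact A\<close>, of UNIV C] C(1) by metis
  have "{i..i + Max J} \<inter> {n. (T ^^ n) z \<in> U} \<noteq> {}" for i
  proof -
    obtain j where j: "j \<in> J" "(T ^^ i) z \<in> C j" using J(2) orbit[OF \<open>z \<in> A\<close>] by blast
    then have "(T ^^ j) ((T ^^ i) z) \<in> O'" using C(2) orbit[OF \<open>z \<in> A\<close>] by blast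
    then have "(T ^^ (j + i)) z \<in> U"
      using O'(2) orbit[OF orbit[OF \<open>z \<in> A\<close>], of j i] \<open>A \<subseteq> X\<close> by (auto simp: funpow_add_apply)
    moreover have "j + i \<in> {i..i + Max J}" using j(1) J(1) by simp
    ultimately show ?thesis by blast
  qed
  then show ?thesis unfolding syndetic_def by blast
qed

lemma syndetic_common_returns:
  assumes ds: "dynamical_system X T" and dense: "X \<subseteq> closure {x. minimal_point X T x}"
    and "finite \<W>" and W: "\<And>W. W \<in> \<W> \<Longrightarrow> opene X W"
  shows "syndetic {n. \<forall>W\<in>\<W>. \<exists>x\<in>W. (T ^^ n) x \<in> W}"
proof -
  have "\<exists>z. z \<in> W \<and> minimal_point X T z" if "opene X W" for W
  proof -
    obtain P where P: "open P" "W = X \<inter> P" "W \<noteq> {}"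
      using \<open>opene X W\<close> unfolding opene_def openin_open by blast
    then have "P \<inter> closure {x. minimal_point X T x} \<noteq> {}" using dense by blast
    then obtain z where z: "z \<in> P" "minimal_point X T z"
      using open_Int_closure_eq_empty[OF P(1)] by blast
    then have "z \<in> X"
      unfolding minimal_point_def minimal_set_def using closedin_imp_subset by blast
    then show ?thesis using z P(2) by blast
  qed
  then obtain z where z: "\<And>W. W \<in> \<W> \<Longrightarrow> z W \<in> W \<and> minimal_point X T (z W)"
    using W by metis
  define R where "R W = {r. (T ^^ r) (z W) \<in> W}" for W
  have R: "syndetic (R W)" if "W \<in> \<W>" for W
    using syndetic_visits_minimal_point[OF ds] z[OF that] W[OF that]
    unfolding R_def opene_def by blast
  have "syndetic {n. \<forall>W\<in>\<W>. \<exists>r\<in>R W. r + n \<in> R W}"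
    by (rule syndetic_common_differences[OF \<open>finite \<W>\<close> R])
  then show ?thesis
  proof (rule syndetic_shift_superset[where m = 0])
    fix n assume n: "n \<in> {n. \<forall>W\<in>\<W>. \<exists>r\<in>R W. r + n \<in> R W}"
    have "\<exists>x\<in>W. (T ^^ n) x \<in> W" if W_mem: "W \<in> \<W>" for W
    proof -
      obtain r where "r \<in> R W" "n + r \<in> R W" using n W_mem by (auto simp: add.commute)
      then show ?thesis unfolding R_def by (auto simp: funpow_add_apply)
    qed
    then show "0 + n \<in> {n. \<forall>W\<in>\<W>. \<exists>x\<in>W. (T ^^ n) x \<in> W}" by simp
  qed
qed

section \<open>Comparing the notions of sensitivity\<close>

text \<open>
  A single block of sensitivity times suffices for each length: common return times of the open
  witnesses transport it.
\<close>

lemma thick_sens_times_imp_thickly_syndetic: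
  assumes ds: "dynamical_system X T" and dense: "X \<subseteq> closure {x. minimal_point X T x}"
    and U: "opene X U" and thick: "thick (sens_times T U \<delta>)"
  shows "thickly_syndetic (sens_times T U \<delta>)"
  unfolding thickly_syndetic_def
proof (intro allI impI)
  fix N :: nat assume "N \<ge> 1"
  then obtain m where m: "{m..<m+N} \<subseteq> sens_times T U \<delta>"
    using thick unfolding thick_def by blast
  have "\<exists>V W. opene X V \<and> opene X W \<and> V \<subseteq> U \<and> W \<subseteq> U \<and>
      (\<forall>a\<in>V. \<forall>b\<in>W. dist ((T ^^ k) a) ((T ^^ k) b) > \<delta>)" if "k \<in> {m..<m+N}" for k
    using sens_times_open_witnesses[OF ds U, of k \<delta>] m that by (metis subsetD)
  then obtain V W where VW: "\<And>k. k \<in> {m..<m+N} \<Longrightarrow> opene X (V k) \<and> opene X (W k) \<and>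
      V k \<subseteq> U \<and> W k \<subseteq> U \<and> (\<forall>a\<in>V k. \<forall>b\<in>W k. dist ((T ^^ k) a) ((T ^^ k) b) > \<delta>)"
    by metis
  define \<W> where "\<W> = V ` {m..<m+N} \<union> W ` {m..<m+N}"
  have "finite \<W>" unfolding \<W>_def by simp
  moreover have "opene X S" if "S \<in> \<W>" for S using that VW unfolding \<W>_def by blast
  ultimately have "syndetic {n. \<forall>S\<in>\<W>. \<exists>x\<in>S. (T ^^ n) x \<in> S}"
    using syndetic_common_returns[OF ds dense] by blast
  then show "syndetic {i. {i..<i+N} \<subseteq> sens_times T U \<delta>}"
  proof (rule syndetic_shift_superset[where m = m])
    fix n assume n: "n \<in> {n. \<forall>S\<in>\<W>. \<exists>x\<in>S. (T ^^ n) x \<in> S}"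
    have "j \<in> sens_times T U \<delta>" if "j \<in> {m+n..<m+n+N}" for j
    proof -
      define k where "k = j - n"
      have k: "k \<in> {m..<m+N}" "j = k + n" using that by (auto simp: k_def)
      then have "V k \<in> \<W>" "W k \<in> \<W>" by (auto simp: \<W>_def)
      then obtain x y where "x \<in> V k" "(T ^^ n) x \<in> V k" "y \<in> W k" "(T ^^ n) y \<in> W k"
        using n by blast
      then have "x \<in> U" "y \<in> U" "dist ((T ^^ j) x) ((T ^^ j) y) > \<delta>"
        using VW[OF k(1)] by (auto simp: k(2) funpow_add_apply)
      then show ?thesis unfolding sens_times_def by blast
    qed
    then show "m + n \<in> {i. {i..<i+N} \<subseteq> sens_times T U \<delta>}" by blast
  qed
qed

lemma thickly_syndetically_sensitive_imp_multi_sensitive: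
  assumes "thickly_syndetically_sensitive X T"
  shows "multi_sensitive X T"
proof -
  obtain \<delta> where \<delta>: "\<delta> > 0" "\<And>U. opene X U \<Longrightarrow> thickly_syndetic (sens_times T U \<delta>)"
    using assms unfolding thickly_syndetically_sensitive_def by blast
  have "(\<Inter>U\<in>\<U>. sens_times T U \<delta>) \<noteq> {}"
    if "finite \<U>" "\<U> \<noteq> {}" "\<forall>U\<in>\<U>. opene X U" for \<U>
    using thickly_syndetic_INT[of \<U> "\<lambda>U. sens_times T U \<delta>"] that \<delta>(2)
      thickly_syndetic_imp_thick thick_nonempty by blast
  then show ?thesis using \<delta>(1) unfolding multi_sensitive_def by blast
qed

text \<open>
  If \<open>n \<ge> i\<close> is a sensitivity time of the preimage of \<open>U\<close> under the \<open>i\<close>-th iterate, then \<open>n - i\<close>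
  is one of \<open>U\<close>. A common sensitivity time of many preimages thus becomes a run.
\<close>

lemma multi_sensitive_imp_thickly_sensitive:
  assumes ds: "dynamical_system X T" and "multi_sensitive X T"
  shows "thickly_sensitive X T"
proof -
  obtain \<delta> where \<delta>: "\<delta> > 0" and multi: "\<forall>\<U>. finite \<U> \<and> \<U> \<noteq> {} \<and> (\<forall>U\<in>\<U>. opene X U) \<longrightarrow>
      (\<Inter>U\<in>\<U>. sens_times T U \<delta>) \<noteq> {}"
    using assms(2) unfolding multi_sensitive_def by (elim exE conjE)
  have "\<exists>m\<ge>1. {m..<m+N} \<subseteq> sens_times T U \<delta>" if U: "opene X U" for U N
  proof -
    obtain V where V: "opene X V" "\<And>n. n \<in> sens_times T V \<delta> \<Longrightarrow> n > N"
      using ex_opene_late_sens_times[OF ds \<delta>] by metis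
    define P where "P i = X \<inter> (T ^^ i) -` U" for i
    have "(\<Inter>S\<in>insert V (P ` {..N}). sens_times T S \<delta>) \<noteq> {}"
      by (rule multi[rule_format]) (use V(1) opene_funpow_vimage[OF ds U] in \<open>auto simp: P_def\<close>)
    then obtain n where "n \<in> (\<Inter>S\<in>insert V (P ` {..N}). sens_times T S \<delta>)" by blast
    then have n: "n \<in> sens_times T V \<delta>" "\<And>i. i \<le> N \<Longrightarrow> n \<in> sens_times T (P i) \<delta>"
      by auto
    have "n > N" using V(2) n(1) by blast
    have "j \<in> sens_times T U \<delta>" if "j \<in> {n-N..<n-N+N}" for j
    proof -
      define i where "i = n - j"
      have i: "i \<le> N" "n = j + i" using that \<open>n > N\<close> by (auto simp: i_def)
      obtain x y where "x \<in> P i" "y \<in> P i" "dist ((T ^^ n) x) ((T ^^ n) y) > \<delta>"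
        using n(2)[OF i(1)] unfolding sens_times_def by blast
      then show ?thesis
        unfolding sens_times_def P_def i(2) funpow_add_apply by blast
    qed
    then have "{n-N..<n-N+N} \<subseteq> sens_times T U \<delta>" by blast
    moreover have "n - N \<ge> 1" using \<open>n > N\<close> by simp
    ultimately show ?thesis by blast
  qed
  then have "\<forall>U. opene X U \<longrightarrow> thick (sens_times T U \<delta>)" by (simp add: thick_def)
  then show ?thesis unfolding thickly_sensitive_def by (intro exI[of _ \<delta>] conjI \<delta>)
qed

theorem theorem4p2:
  fixes X :: "'a::metric_space set" and T :: "'a \<Rightarrow> 'a"
  assumes "M_system X T"
  shows "(thickly_syndetically_sensitive X T \<longleftrightarrow> multi_sensitive X T) \<and>
         (multi_sensitive X T \<longleftrightarrow> thickly_sensitive X T)"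
proof -
  have ds: "dynamical_system X T" and dense: "X \<subseteq> closure {x. minimal_point X T x}"
    using assms unfolding M_system_def transitive_system_def by auto
  have "thickly_syndetically_sensitive X T" if sens: "thickly_sensitive X T"
  proof -
    obtain \<delta> where "\<delta> > 0" and thick: "\<And>U. opene X U \<Longrightarrow> thick (sens_times T U \<delta>)"
      using sens unfolding thickly_sensitive_def by auto
    moreover have "thickly_syndetic (sens_times T U \<delta>)" if "opene X U" for U
      by (rule thick_sens_times_imp_thickly_syndetic[OF ds dense that thick[OF that]])
    ultimately show ?thesis unfolding thickly_syndetically_sensitive_def by auto
  qed
  moreover have "multi_sensitive X T" if "thickly_syndetically_sensitive X T"
    using that by (rule thickly_syndetically_sensitive_imp_multi_sensitive)
  moreover have "thickly_sensitive X T" if "multi_sensitive X T"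
    by (rule multi_sensitive_imp_thickly_sensitive[OF ds that])
  ultimately show ?thesis by argo
qed

end
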